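(* Suppose $m$ is a positive integer and $s=(3^{m+1}-1)/2$. Then \[R_2(s)\ge\frac{40\times 3^{2m-3}}{(3^{m+1}-1)(3^m-1)}.\]
   Context: All invertibility is over $\mathbb{F}_2$. For an $s\times s$ invertible $0$-$1$ matrix $M$, $N_2(M)$ is the number of invertible $2\times2$ submatrices of $M$ (one for each choice of two rows and two columns), $R_2(M)=N_2(M)/\binom{s}{2}^2$, and $R_2(s)=\max\{R_2(M): M \text{ is an } s\times s \text{ invertible } 0\text{-}1 \text{ matrix}\}$. *)

theory Defs
  imports
    Complex_Main
    "HOL-Library.Z2"
    "Jordan_Normal_Form.DL_Submatrix"
begin

text \<open>
  Zero-one matrices are represented as matrices over the two-element field \<^typ>\<open>bit\<close>, so that
  \<^const>\<open>invertible_mat\<close> is invertibility over that field.  Rows and columns are indexed from 0.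
\<close>

definition N2 :: "bit mat \<Rightarrow> nat" where
  "N2 M = card {(I, J). I \<subseteq> {..<dim_row M} \<and> card I = 2 \<and>
                        J \<subseteq> {..<dim_col M} \<and> card J = 2 \<and>
                        invertible_mat (submatrix M I J)}"

definition R2 :: "bit mat \<Rightarrow> real" where
  "R2 M = real (N2 M) / (real (dim_row M choose 2))\<^sup>2"

definition R2_max :: "nat \<Rightarrow> real" where
  "R2_max s = Max {R2 M | M. M \<in> carrier_mat s s \<and> invertible_mat M}"

text \<open>The maximum is over a finite nonempty set, so \<^const>\<open>Max\<close> is meaningful here.\<close>

lemma R2_values_finite: "finite {R2 M | M. M \<in> carrier_mat s s \<and> invertible_mat M}"
proof -
  let ?P = "Pow {..<s} \<times> Pow {..<s}"
  have "N2 M \<le> card ?P" if "M \<in> carrier_mat s s" for M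
    unfolding N2_def by (rule card_mono) (use that in auto)
  then have "{R2 M | M. M \<in> carrier_mat s s \<and> invertible_mat M}
      \<subseteq> (\<lambda>n. real n / (real (s choose 2))\<^sup>2) ` {..card ?P}"
    unfolding R2_def by fastforce
  then show ?thesis
    using finite_surj by blast
qed

lemma R2_values_nonempty: "{R2 M | M. M \<in> carrier_mat s s \<and> invertible_mat M} \<noteq> {}"
proof -
  have "invertible_mat (1\<^sub>m s :: bit mat)"
    unfolding invertible_mat_def inverts_mat_def by (auto intro!: exI[of _ "1\<^sub>m s"])
  then show ?thesis
    using one_carrier_mat by blast
qed

end

theory Submission
  imports Defs
begin

text \<open>
  Index rows and columns by the \<open>s\<close> points of the projective space of dimension \<open>m\<close> over the field
  with three elements, and put a 1 where the scalar product of two representatives is nonzero.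
  The rows form a ternary simplex code up to signs: every row has weight \<open>3 ^ m\<close>, and because
  exactly one of \<open>a + b\<close>, \<open>a - b\<close> vanishes when \<open>a\<close> and \<open>b\<close> are nonzero modulo 3, the
  supports of two rows meet in exactly \<open>2 * 3 ^ (m - 1)\<close> points. Since the first number is odd and
  the second is even, the matrix is its own inverse over \<open>\<F>\<^sub>2\<close>. The columns of two rows contain
  \<open>(1,1)\<close>, \<open>(1,0)\<close>, \<open>(0,1)\<close> with multiplicities \<open>2q, q, q\<close> for \<open>q = 3 ^ (m - 1)\<close>, so every pair of
  rows contributes \<open>5 q\<^sup>2\<close> invertible submatrices.
\<close>

section \<open>Points of projective space over the field with three elements\<close>

text \<open>Scalar products are integers that are only tested for divisibility by 3, so entries of
  sums and differences need no reduction to 0, 1, 2.\<close>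

fun dot :: "int list \<Rightarrow> int list \<Rightarrow> int" where
  "dot (a # u) (b # v) = a * b + dot u v"
| "dot _ _ = 0"

definition nonzero3 :: "int list \<Rightarrow> bool" where
  "nonzero3 u \<longleftrightarrow> (\<exists>a\<in>set u. \<not> 3 dvd a)"

fun vecs :: "nat \<Rightarrow> int list list" where
  "vecs 0 = [[]]"
| "vecs (Suc n) = map ((#) 0) (vecs n) @ map ((#) 1) (vecs n) @ map ((#) 2) (vecs n)"

text \<open>Each point is represented by its unique vector with first nonzero entry 1.\<close>

fun points :: "nat \<Rightarrow> int list list" where
  "points 0 = []"
| "points (Suc n) = map ((#) 0) (points n) @ map ((#) 1) (vecs n)"

section \<open>Basic facts on scalar products and representatives\<close>

lemma nonzero3_simps [simp]:
  "\<not> nonzero3 []"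
  "nonzero3 (a # u) \<longleftrightarrow> \<not> 3 dvd a \<or> nonzero3 u"
  by (auto simp: nonzero3_def)

lemma dot_commute: "dot u v = dot v u"
  by (induction u v rule: dot.induct) auto

lemma dot_add:
  "length u = length u' \<Longrightarrow> dot (map2 (+) u u') v = dot u v + dot u' v"
proof (induction u u' arbitrary: v rule: list_induct2)
  case (Cons a u b u')
  then show ?case by (cases v) (simp_all add: algebra_simps)
qed simp

lemma dot_diff:
  "length u = length u' \<Longrightarrow> dot (map2 (-) u u') v = dot u v - dot u' v"
proof (induction u u' arbitrary: v rule: list_induct2)
  case (Cons a u b u')
  then show ?case by (cases v) (simp_all add: algebra_simps)
qed simp

lemma dvd_dot_if_not_nonzero3: "\<not> nonzero3 u \<Longrightarrow> 3 dvd dot u v"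
  by (induction u v rule: dot.induct) auto

lemma length_vecs: "length (vecs n) = 3 ^ n"
  by (induction n) auto

lemma length_if_in_vecs: "v \<in> set (vecs n) \<Longrightarrow> length v = n"
  by (induction n arbitrary: v) auto

lemma length_points: "2 * length (points n) = 3 ^ n - 1"
proof (induction n)
  case (Suc n)
  have "(3::nat) ^ n \<ge> 1" by simp
  with Suc show ?case by (simp add: length_vecs)
qed simp

lemma length_if_in_points: "v \<in> set (points n) \<Longrightarrow> length v = n"
  by (induction n arbitrary: v) (auto dest: length_if_in_vecs)

lemma nonzero3_if_in_points: "v \<in> set (points n) \<Longrightarrow> nonzero3 v"
  by (induction n arbitrary: v) auto

lemma distinct_vecs: "distinct (vecs n)"
  by (induction n) (auto simp: distinct_map inj_on_def)

lemma distinct_points: "distinct (points n)"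
  by (induction n) (auto simp: distinct_map inj_on_def distinct_vecs)

text \<open>Entries lie in {0, 1, 2}, so two different ones differ by at most 2 and stay different
  modulo 3.\<close>

lemma nonzero3_diff_vecs:
  "\<lbrakk>u \<in> set (vecs n); v \<in> set (vecs n); u \<noteq> v\<rbrakk> \<Longrightarrow> nonzero3 (map2 (-) u v)"
proof (induction n arbitrary: u v)
  case (Suc n)
  obtain a u' b v' where uv: "u = a # u'" "v = b # v'"
    using Suc.prems by auto
  show ?case
  proof (cases "a = b")
    case True
    then show ?thesis
      using Suc.prems Suc.IH[of u' v'] unfolding uv by (auto)
  next
    case False
    then show ?thesis
      using Suc.prems unfolding uv by auto
  qed
qed simp

lemma nonzero3_diff_points:
  "\<lbrakk>u \<in> set (points n); v \<in> set (points n); u \<noteq> v\<rbrakk> \<Longrightarrow> nonzero3 (map2 (-) u v)"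
proof (induction n arbitrary: u v)
  case (Suc n)
  obtain a u' b v' where uv: "u = a # u'" "v = b # v'"
    using Suc.prems by auto
  show ?case
  proof (cases "a = b")
    case True
    then show ?thesis
      using Suc.prems Suc.IH[of u' v'] unfolding uv by (auto simp: nonzero3_diff_vecs)
  next
    case False
    then show ?thesis
      using Suc.prems unfolding uv by auto
  qed
qed simp

text \<open>The normalisation to leading entry 1 excludes \<open>v = -u\<close> modulo 3. First
  entries are 0 or 1, so their sum is 1 or 2 unless both are 0, and then the tails are distinct
  points.\<close>

lemma nonzero3_add_points:
  "\<lbrakk>u \<in> set (points n); v \<in> set (points n); u \<noteq> v\<rbrakk> \<Longrightarrow> nonzero3 (map2 (+) u v)"
proof (induction n arbitrary: u v)
  case (Suc n)
  obtain a u' b v' where uv: "u = a # u'" "v = b # v'"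
    using Suc.prems by auto
  show ?case
  proof (cases "a = b")
    case True
    then show ?thesis
      using Suc.prems Suc.IH[of u' v'] unfolding uv by (auto)
  next
    case False
    then show ?thesis
      using Suc.prems unfolding uv by auto
  qed
qed simp

text \<open>A nonconstant affine form vanishes on a third of the space. The constant
  \<open>c\<close> is arbitrary because fixing the first coordinate shifts it by 0, \<open>a\<close>
  or \<open>2 * a\<close>.\<close>

lemma filter_vecs_affine:
  assumes "length u = n" "nonzero3 u"
  shows "3 * length (filter (\<lambda>v. 3 dvd c + dot u v) (vecs n)) = 3 ^ n"
  using assms
proof (induction n arbitrary: u c)
  case (Suc n)
  then obtain a u' where u: "u = a # u'" "length u' = n"
    by (auto simp: length_Suc_conv)
  let ?N = "\<lambda>c. length (filter (\<lambda>v. 3 dvd c + dot u' v) (vecs n))"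
  have split: "length (filter (\<lambda>v. 3 dvd c + dot u v) (vecs (Suc n)))
      = ?N c + ?N (c + a) + ?N (c + a * 2)"
    by (simp add: u filter_map o_def add.assoc)
  show ?case
  proof (cases "nonzero3 u'")
    case True
    with Suc.IH[OF u(2)] split show ?thesis
      by (simp add: distrib_left)
  next
    case False
    then have a: "\<not> 3 dvd a"
      using Suc.prems u by simp
    have "3 dvd d + dot u' v \<longleftrightarrow> 3 dvd d" for d v
      using dvd_dot_if_not_nonzero3[OF False] by (simp add: dvd_add_left_iff)
    then have N: "?N d = (if 3 dvd d then 3 ^ n else 0)" for d
      by (simp add: length_vecs)
    \<comment> \<open>Since \<open>a\<close> is a unit modulo 3, \<open>c + a * x\<close> vanishes
      for exactly one \<open>x\<close> in {0, 1, 2}, and that block is counted in full.\<close>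
    have "3 dvd c \<and> \<not> 3 dvd c + a \<and> \<not> 3 dvd c + a * 2 \<or>
          \<not> 3 dvd c \<and> 3 dvd c + a \<and> \<not> 3 dvd c + a * 2 \<or>
          \<not> 3 dvd c \<and> \<not> 3 dvd c + a \<and> 3 dvd c + a * 2"
      using a by presburger
    then show ?thesis
      unfolding split N by auto
  qed
qed simp

text \<open>Points with first entry 0 fall to the induction; those with first entry 1 give an affine
  form on \<open>vecs\<close>. In the induction step with a nonzero tail the two parts are
  \<open>3 ^ n\<close> and \<open>2 * 3 ^ n\<close>; with a zero tail they are 0 and
  \<open>3 ^ Suc n\<close>.\<close>

lemma filter_points_weight:
  assumes "length u = Suc n" "nonzero3 u"
  shows "length (filter (\<lambda>v. \<not> 3 dvd dot u v) (points (Suc n))) = 3 ^ n"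
  using assms
proof (induction n arbitrary: u)
  case 0
  then show ?case by (auto simp: length_Suc_conv)
next
  case (Suc n)
  then obtain a u' where u: "u = a # u'" "length u' = Suc n"
    by (auto simp: length_Suc_conv)
  let ?W = "length (filter (\<lambda>v. \<not> 3 dvd dot u' v) (points (Suc n)))"
  let ?N = "length (filter (\<lambda>v. \<not> 3 dvd a + dot u' v) (vecs (Suc n)))"
  have split: "length (filter (\<lambda>v. \<not> 3 dvd dot u v) (points (Suc (Suc n)))) = ?W + ?N"
    by (subst points.simps) (simp add: u filter_map o_def del: points.simps vecs.simps)
  show ?case
  proof (cases "nonzero3 u'")
    case True
    have "length (filter (\<lambda>v. 3 dvd a + dot u' v) (vecs (Suc n))) + ?N = 3 ^ Suc n"
      using sum_length_filter_compl[of "\<lambda>v. 3 dvd a + dot u' v" "vecs (Suc n)"]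
      by (simp add: length_vecs del: vecs.simps)
    with filter_vecs_affine[OF u(2) True, of a] Suc.IH[OF u(2) True] split show ?thesis
      by simp
  next
    case False
    then have "\<not> 3 dvd a + dot u' v" for v
      using Suc.prems u dvd_dot_if_not_nonzero3[OF False] by (simp add: dvd_add_left_iff)
    moreover have "?W = 0"
      using dvd_dot_if_not_nonzero3[OF False] by (simp del: points.simps)
    ultimately show ?thesis
      using split by (simp add: length_vecs del: vecs.simps points.simps)
  qed
qed

text \<open>Each \<open>x\<close> contributes equally to both sides: 0 if both values vanish modulo
  3, 2 if exactly one does, and 4 if neither does, as then exactly one of sum and difference
  vanishes.\<close>

lemma filter_sum_diff_count:
  fixes f g :: "'a \<Rightarrow> int"
  shows "length (filter (\<lambda>x. \<not> 3 dvd f x + g x) xs) + length (filter (\<lambda>x. \<not> 3 dvd f x - g x) xs)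
      + 3 * length (filter (\<lambda>x. \<not> 3 dvd f x \<and> \<not> 3 dvd g x) xs)
    = 2 * length (filter (\<lambda>x. \<not> 3 dvd f x) xs) + 2 * length (filter (\<lambda>x. \<not> 3 dvd g x) xs)"
proof (induction xs)
  case (Cons x xs)
  have mod3: "3 dvd a \<and> 3 dvd b \<and> 3 dvd a + b \<and> 3 dvd a - b
    \<or> (3 dvd a) \<noteq> (3 dvd b) \<and> \<not> 3 dvd a + b \<and> \<not> 3 dvd a - b
    \<or> \<not> 3 dvd a \<and> \<not> 3 dvd b \<and> (3 dvd a + b) \<noteq> (3 dvd a - b)" for a b :: int
    by presburger
  show ?case
    using Cons mod3[of "f x" "g x"] by auto
qed simp

text \<open>The vectors \<open>u\<close>, \<open>v\<close>, \<open>u + v\<close>,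
  \<open>u - v\<close> all have weight \<open>3 ^ n\<close>, so the preceding identity reads
  \<open>2 * 3 ^ n + 3 * x = 4 * 3 ^ n\<close>.\<close>

lemma filter_points_pair:
  assumes "u \<in> set (points (Suc n))" "v \<in> set (points (Suc n))" "u \<noteq> v"
  shows "3 * length (filter (\<lambda>w. \<not> 3 dvd dot u w \<and> \<not> 3 dvd dot v w) (points (Suc n))) = 2 * 3 ^ n"
proof -
  have len: "length u = Suc n" "length v = Suc n"
    using assms by (auto dest: length_if_in_points simp del: points.simps)
  have weights:
    "length (filter (\<lambda>w. \<not> 3 dvd dot u w) (points (Suc n))) = 3 ^ n"
    "length (filter (\<lambda>w. \<not> 3 dvd dot v w) (points (Suc n))) = 3 ^ n"
    "length (filter (\<lambda>w. \<not> 3 dvd dot u w + dot v w) (points (Suc n))) = 3 ^ n"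
    "length (filter (\<lambda>w. \<not> 3 dvd dot u w - dot v w) (points (Suc n))) = 3 ^ n"
    using filter_points_weight[OF len(1) nonzero3_if_in_points[OF assms(1)]]
      filter_points_weight[OF len(2) nonzero3_if_in_points[OF assms(2)]]
      filter_points_weight[OF _ nonzero3_add_points[OF assms]]
      filter_points_weight[OF _ nonzero3_diff_points[OF assms]] len
    by (simp_all add: dot_add dot_diff del: points.simps)
  show ?thesis
    using filter_sum_diff_count[of "dot u" "dot v" "points (Suc n)"] unfolding weights by simp
qed

section \<open>The non-incidence matrix\<close>

text \<open>Row \<open>i\<close> stands for the hyperplane orthogonal to point \<open>i\<close>; a 1
  marks a point off it. Changing the sign of a representative leaves the entry unchanged.\<close>

definition nonincidence_mat :: "nat \<Rightarrow> bit mat" where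
  "nonincidence_mat n = mat (length (points n)) (length (points n))
     (\<lambda>(i, j). of_bool (\<not> 3 dvd dot (points n ! i) (points n ! j)))"

lemma nonincidence_mat_carrier:
  "nonincidence_mat n \<in> carrier_mat (length (points n)) (length (points n))"
  by (simp add: nonincidence_mat_def)

lemma nonincidence_mat_index:
  "\<lbrakk>i < length (points n); j < length (points n)\<rbrakk>
   \<Longrightarrow> nonincidence_mat n $$ (i, j) = of_bool (\<not> 3 dvd dot (points n ! i) (points n ! j))"
  by (simp add: nonincidence_mat_def)

lemma nonincidence_row_weight:
  assumes "i < length (points (Suc n))"
  shows "card {k. k < length (points (Suc n)) \<and> nonincidence_mat (Suc n) $$ (i, k) = 1} = 3 ^ n"
proof -
  have u: "points (Suc n) ! i \<in> set (points (Suc n))"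
    using assms by (rule nth_mem)
  have "{k. k < length (points (Suc n)) \<and> nonincidence_mat (Suc n) $$ (i, k) = 1}
      = {k. k < length (points (Suc n)) \<and> \<not> 3 dvd dot (points (Suc n) ! i) (points (Suc n) ! k)}"
    using assms by (auto simp: nonincidence_mat_index simp del: points.simps)
  then show ?thesis
    using filter_points_weight[OF length_if_in_points[OF u] nonzero3_if_in_points[OF u]]
    by (simp only: length_filter_conv_card)
qed

lemma nonincidence_rows_meet:
  assumes "i < length (points (Suc n))" "j < length (points (Suc n))" "i \<noteq> j"
  shows "3 * card {k. k < length (points (Suc n)) \<and>
    nonincidence_mat (Suc n) $$ (i, k) = 1 \<and> nonincidence_mat (Suc n) $$ (j, k) = 1} = 2 * 3 ^ n"
proof -
  have "{k. k < length (points (Suc n)) \<and>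
      nonincidence_mat (Suc n) $$ (i, k) = 1 \<and> nonincidence_mat (Suc n) $$ (j, k) = 1}
    = {k. k < length (points (Suc n)) \<and> \<not> 3 dvd dot (points (Suc n) ! i) (points (Suc n) ! k)
        \<and> \<not> 3 dvd dot (points (Suc n) ! j) (points (Suc n) ! k)}"
    using assms by (auto simp: nonincidence_mat_index simp del: points.simps)
  moreover have "points (Suc n) ! i \<noteq> points (Suc n) ! j"
    using assms distinct_points nth_eq_iff_index_eq by blast
  ultimately show ?thesis
    using filter_points_pair[OF nth_mem[OF assms(1)] nth_mem[OF assms(2)]]
    by (simp only: length_filter_conv_card simp_thms)
qed

lemma nonincidence_mat_involution:
  "nonincidence_mat (Suc n) * nonincidence_mat (Suc n) = 1\<^sub>m (length (points (Suc n)))"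
    (is "?A * ?A = 1\<^sub>m ?s")
proof (rule eq_matI)
  fix i j assume "i < dim_row (1\<^sub>m ?s :: bit mat)" "j < dim_col (1\<^sub>m ?s :: bit mat)"
  then have ij: "i < ?s" "j < ?s" by simp_all
  let ?C = "{k. k < ?s \<and> ?A $$ (i, k) = 1 \<and> ?A $$ (j, k) = 1}"
  have A: "?A \<in> carrier_mat ?s ?s" by (rule nonincidence_mat_carrier)
  have sym: "?A $$ (k, j) = ?A $$ (j, k)" if "k < ?s" for k
    using that ij by (simp add: nonincidence_mat_index dot_commute del: points.simps)
  have "(?A * ?A) $$ (i, j) = (\<Sum>k<?s. ?A $$ (i, k) * ?A $$ (k, j))"
    using ij A by (auto simp: scalar_prod_def lessThan_atLeast0 simp del: points.simps)
  \<comment> \<open>By symmetry column \<open>j\<close> is row \<open>j\<close>, so the entry is the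
    parity of the number of common ones of two rows.\<close>
  also have "\<dots> = (\<Sum>k<?s. of_bool (?A $$ (i, k) = 1 \<and> ?A $$ (j, k) = 1))"
    by (intro sum.cong) (auto simp: sym simp del: points.simps)
  also have "\<dots> = of_nat (card ?C)"
    by (simp add: Int_def del: points.simps)
  also have "\<dots> = (1\<^sub>m ?s) $$ (i, j)"
  proof (cases "i = j")
    case True
    then have "card ?C = 3 ^ n"
      using nonincidence_row_weight[OF ij(1)] by (simp del: points.simps)
    then have "odd (card ?C)" by simp
    then have "odd (of_nat (card ?C) :: bit)" by (simp only: even_of_nat_iff not_False_eq_True)
    then show ?thesis
      using True ij by (cases "of_nat (card ?C) :: bit") (simp_all del: points.simps of_nat_power)
  next
    case False
    have "even (3 * card ?C)"
      unfolding nonincidence_rows_meet[OF ij False] by simp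
    then have "even (card ?C)" by simp
    then have "even (of_nat (card ?C) :: bit)" by (simp only: even_of_nat_iff)
    then show ?thesis
      using False ij by (cases "of_nat (card ?C) :: bit") (simp_all del: points.simps)
  qed
  finally show "(?A * ?A) $$ (i, j) = (1\<^sub>m ?s) $$ (i, j)" .
qed (use nonincidence_mat_carrier[of "Suc n"] in auto)

lemma invertible_nonincidence_mat: "invertible_mat (nonincidence_mat (Suc n))"
proof -
  let ?A = "nonincidence_mat (Suc n)"
  have "dim_row ?A = length (points (Suc n))" "dim_col ?A = length (points (Suc n))"
    using nonincidence_mat_carrier[of "Suc n"] by blast+
  then show ?thesis
    using nonincidence_mat_involution[of n]
    unfolding invertible_mat_def inverts_mat_def square_mat.simps by metis
qed

section \<open>Counting invertible submatrices of order two\<close>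

text \<open>The hypothesis \<open>det\<close> says that the determinant is 1, so the adjugate is an
  inverse.\<close>

lemma invertible_submatrix_pair_less:
  fixes A :: "bit mat"
  assumes "a < b" "b < dim_row A" "j < k" "k < dim_col A"
    and det: "A $$ (a, j) * A $$ (b, k) + A $$ (a, k) * A $$ (b, j) = 1"
  shows "invertible_mat (submatrix A {a, b} {j, k})"
proof -
  let ?S = "submatrix A {a, b} {j, k}"
  \<comment> \<open>The adjugate: the diagonal is swapped, and the off-diagonal entries stay because
    -1 = 1.\<close>
  let ?T = "mat 2 2 (\<lambda>(x, y). if x = y then ?S $$ (1 - x, 1 - x) else ?S $$ (x, y)) :: bit mat"
  \<comment> \<open>An entry's position in the submatrix is the number of selected indices below its
    own.\<close>
  have sets: "{x \<in> {a, b}. x < a} = {}" "{x \<in> {a, b}. x < b} = {a}"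
    "{x \<in> {j, k}. x < j} = {}" "{x \<in> {j, k}. x < k} = {j}"
    using assms by auto
  have "{i. i < dim_row A \<and> i \<in> {a, b}} = {a, b}" "{i. i < dim_col A \<and> i \<in> {j, k}} = {j, k}"
    using assms by auto
  then have S: "?S \<in> carrier_mat 2 2"
    using assms by (intro carrier_matI) (simp_all add: dim_submatrix)
  have entries: "?S $$ (0, 0) = A $$ (a, j)" "?S $$ (0, Suc 0) = A $$ (a, k)"
    "?S $$ (Suc 0, 0) = A $$ (b, j)" "?S $$ (Suc 0, Suc 0) = A $$ (b, k)"
    using submatrix_index_card[of a A j "{a, b}" "{j, k}"]
      submatrix_index_card[of a A k "{a, b}" "{j, k}"]
      submatrix_index_card[of b A j "{a, b}" "{j, k}"]
      submatrix_index_card[of b A k "{a, b}" "{j, k}"] assms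
    unfolding sets by simp_all
  have "?S * ?T = 1\<^sub>m 2" "?T * ?S = 1\<^sub>m 2"
    using S det
    by (auto intro!: eq_matI simp: scalar_prod_def less_Suc_eq numeral_2_eq_2 entries ac_simps
      simp del: mult_bit_eq_and add_bit_eq_xor)
  then show ?thesis
    using S unfolding invertible_mat_def inverts_mat_def by (intro conjI exI[of _ ?T]) auto
qed

text \<open>Exchanging rows or columns only permutes the two summands of the determinant, which
  carry no signs over \<open>bit\<close>.\<close>

lemma invertible_submatrix_pair:
  fixes A :: "bit mat"
  assumes "a < dim_row A" "b < dim_row A" "a \<noteq> b" "j < dim_col A" "k < dim_col A" "j \<noteq> k"
    and "A $$ (a, j) * A $$ (b, k) + A $$ (a, k) * A $$ (b, j) = 1"
  shows "invertible_mat (submatrix A {a, b} {j, k})"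
proof -
  consider "a < b" "j < k" | "a < b" "k < j" | "b < a" "j < k" | "b < a" "k < j"
    using assms by linarith
  then show ?thesis
    using assms invertible_submatrix_pair_less[of a b A j k]
      invertible_submatrix_pair_less[of a b A k j]
      invertible_submatrix_pair_less[of b a A j k]
      invertible_submatrix_pair_less[of b a A k j]
    by cases (simp_all add: insert_commute ac_simps del: mult_bit_eq_and add_bit_eq_xor)
qed

text \<open>Disjointness lets the set {x, y} reveal which element came from which side.\<close>

lemma card_unordered_pairs:
  assumes "X \<inter> Y = {}"
  shows "card ((\<lambda>(x, y). {x, y}) ` (X \<times> Y)) = card X * card Y"
proof -
  have "inj_on (\<lambda>(x, y). {x, y}) (X \<times> Y)"
    using assms by (auto simp: inj_on_def doubleton_eq_iff)
  then show ?thesis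
    by (simp add: card_image card_cartesian_product)
qed

lemma card_invertible_column_pairs:
  fixes A :: "bit mat"
  assumes "a < dim_row A" "b < dim_row A" "a \<noteq> b"
    and row_a: "card {k. k < dim_col A \<and> A $$ (a, k) = 1} = 3 * q"
    and row_b: "card {k. k < dim_col A \<and> A $$ (b, k) = 1} = 3 * q"
    and meet: "card {k. k < dim_col A \<and> A $$ (a, k) = 1 \<and> A $$ (b, k) = 1} = 2 * q"
  shows "5 * q\<^sup>2 \<le> card {J. J \<subseteq> {..<dim_col A} \<and> card J = 2 \<and> invertible_mat (submatrix A {a, b} J)}"
    (is "_ \<le> card ?G")
proof -
  let ?X = "{k. k < dim_col A \<and> A $$ (a, k) = 1 \<and> A $$ (b, k) = 1}"
  let ?Y = "{k. k < dim_col A \<and> A $$ (a, k) = 1 \<and> A $$ (b, k) = 0}"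
  let ?Z = "{k. k < dim_col A \<and> A $$ (a, k) = 0 \<and> A $$ (b, k) = 1}"
  let ?pairs = "\<lambda>P Q. (\<lambda>(x, y). {x, y}) ` (P \<times> Q)"
  have "{k. k < dim_col A \<and> A $$ (a, k) = 1} = ?X \<union> ?Y"
    "{k. k < dim_col A \<and> A $$ (b, k) = 1} = ?X \<union> ?Z" by auto
  moreover have "card (?X \<union> ?Y) = card ?X + card ?Y" "card (?X \<union> ?Z) = card ?X + card ?Z"
    by (rule card_Un_disjoint; auto)+
  ultimately have YZ: "card ?Y = q" "card ?Z = q"
    using row_a row_b meet by simp_all
  \<comment> \<open>Two distinct nonzero vectors of length 2 over \<open>bit\<close> are
    independent, so columns from different classes give an invertible submatrix.\<close>
  have sub: "?pairs ?X ?Y \<union> ?pairs ?X ?Z \<union> ?pairs ?Y ?Z \<subseteq> ?G"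
    using assms(1-3) by (auto intro!: invertible_submatrix_pair simp: card_insert_if)
  have disj: "?pairs ?X ?Y \<inter> ?pairs ?X ?Z = {}"
    "(?pairs ?X ?Y \<union> ?pairs ?X ?Z) \<inter> ?pairs ?Y ?Z = {}"
    by (auto simp: doubleton_eq_iff)
  have fin: "finite ?X" "finite ?Y" "finite ?Z" by auto
  have "card (?pairs ?X ?Y \<union> ?pairs ?X ?Z \<union> ?pairs ?Y ?Z)
      = card (?pairs ?X ?Y) + card (?pairs ?X ?Z) + card (?pairs ?Y ?Z)"
    using fin disj by (simp add: card_Un_disjoint)
  also have "\<dots> = card ?X * card ?Y + card ?X * card ?Z + card ?Y * card ?Z"
    by (subst card_unordered_pairs, force)+ simp
  \<comment> \<open>The class sizes \<open>2 * q\<close>, \<open>q\<close>, \<open>q\<close> give 2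
    + 2 + 1.\<close>
  also have "\<dots> = 5 * q\<^sup>2"
    unfolding meet YZ by (simp add: power2_eq_square)
  finally show ?thesis
    using card_mono[OF _ sub] by simp
qed

text \<open>The second \<open>Suc\<close> makes the row weight \<open>3 * q\<close> and the meet
  \<open>2 * q\<close> with \<open>q = 3 ^ n\<close>. The bound for one pair of rows is summed over
  all pairs.\<close>

lemma N2_nonincidence_mat:
  "5 * (3 ^ n)\<^sup>2 * (length (points (Suc (Suc n))) choose 2) \<le> N2 (nonincidence_mat (Suc (Suc n)))"
proof -
  let ?A = "nonincidence_mat (Suc (Suc n))" and ?s = "length (points (Suc (Suc n)))"
  let ?R = "{I. I \<subseteq> {..<?s} \<and> card I = 2}"
  let ?G = "\<lambda>I. {J. J \<subseteq> {..<?s} \<and> card J = 2 \<and> invertible_mat (submatrix ?A I J)}"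
  have dims: "dim_row ?A = ?s" "dim_col ?A = ?s"
    using nonincidence_mat_carrier[of "Suc (Suc n)"] by blast+
  have "5 * (3 ^ n)\<^sup>2 \<le> card (?G I)" if I: "I \<in> ?R" for I
  proof -
    from I obtain a b where ab: "I = {a, b}" "a \<noteq> b" "a < ?s" "b < ?s"
      by (auto simp: card_2_iff simp del: points.simps)
    show ?thesis
      using card_invertible_column_pairs[of a ?A b "3 ^ n"] ab
        nonincidence_row_weight[OF ab(3)] nonincidence_row_weight[OF ab(4)]
        nonincidence_rows_meet[OF ab(3,4,2)]
      unfolding dims by (simp del: points.simps)
  qed
  then have "5 * (3 ^ n)\<^sup>2 * card ?R \<le> (\<Sum>I\<in>?R. card (?G I))"
    using sum_mono[of ?R "\<lambda>_. 5 * (3 ^ n)\<^sup>2" "\<lambda>I. card (?G I)"]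
    by (simp add: mult.commute del: points.simps)
  also have "\<dots> = card (Sigma ?R ?G)"
    by (rule card_SigmaI[symmetric]) (auto simp del: points.simps)
  also have "Sigma ?R ?G = {(I, J). I \<subseteq> {..<dim_row ?A} \<and> card I = 2 \<and>
      J \<subseteq> {..<dim_col ?A} \<and> card J = 2 \<and> invertible_mat (submatrix ?A I J)}"
    unfolding dims by auto
  finally show ?thesis
    unfolding N2_def by (simp add: n_subsets del: points.simps)
qed

section \<open>The density of the matrix and the closed form of the bound\<close>

theorem theorem5p4:
  fixes m s :: nat
  assumes "m > 0"
    and "s = (3 ^ (m + 1) - 1) div 2"
  shows "R2_max s \<ge> (40 * 3 powi (2 * int m - 3)) / ((3 ^ (m + 1) - 1) * (3 ^ m - 1))"
proof -
  obtain n where m: "m = Suc n"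
    using assms(1) by (cases m) auto
  let ?A = "nonincidence_mat (Suc (Suc n))"
  define q :: real where "q = 3 ^ n"
  have q: "q \<ge> 1" by (simp add: q_def)
  have s: "length (points (Suc (Suc n))) = s"
    using length_points[of "Suc (Suc n)"] assms(2) by (simp add: m del: points.simps)
  have "2 * s = 3 ^ (m + 1) - 1"
    using length_points[of "Suc (Suc n)"] s by (simp add: m del: points.simps)
  moreover have "(3::nat) ^ (m + 1) \<ge> 1" by simp
  \<comment> \<open>The truncated subtraction is removed before passing to reals.\<close>
  ultimately have "2 * s + 1 = 3 ^ (m + 1)" by linarith
  then have "real (2 * s + 1) = 3 ^ (m + 1)"
    by (metis of_nat_numeral of_nat_power)
  then have s_real: "real s = (9 * q - 1) / 2"
    by (simp add: q_def m)
  define c where "c = real (s choose 2)"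
  \<comment> \<open>This is \<open>s * (s - 1) / 2\<close> with
    \<open>s - 1 = (9 * q - 3) / 2\<close>.\<close>
  have c: "c = 3 * (9 * q - 1) * (3 * q - 1) / 8"
    unfolding c_def binomial_gbinomial by (simp add: gbinomial_prod_rev numeral_2_eq_2 s_real field_simps)
  have c_pos: "c > 0"
    using q unfolding c by simp
  \<comment> \<open>The exponent is -1 for \<open>m = 1\<close>, so one factor 3 is split off as a
    division.\<close>
  have "2 * int m - 3 = int (2 * n) - 1"
    by (simp add: m)
  then have "3 powi (2 * int m - 3) = (3 powi (int (2 * n)) / 3 :: real)"
    by (simp add: power_int_diff)
  also have "\<dots> = q\<^sup>2 / 3"
    by (simp only: q_def power_int_of_nat power_even_eq)
  finally have powi: "3 powi (2 * int m - 3) = q\<^sup>2 / 3" .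
  have "3 ^ (m + 1) = 9 * q" "3 ^ m = 3 * q"
    by (simp_all add: m q_def)
  then have "(40 * 3 powi (2 * int m - 3)) / ((3 ^ (m + 1) - 1) * (3 ^ m - 1))
      = 40 * (q\<^sup>2 / 3) / ((9 * q - 1) * (3 * q - 1))"
    unfolding powi by simp
  also have "\<dots> = 5 * q\<^sup>2 / c"
    using q by (simp add: c divide_simps)
  \<comment> \<open>Expanding by \<open>c\<close> matches \<open>R2\<close>: \<open>c\<close> row
    pairs with \<open>5 * q\<^sup>2\<close> submatrices each, out of
    \<open>c\<^sup>2\<close>.\<close>
  also have "\<dots> = 5 * q\<^sup>2 * c / c\<^sup>2"
    using c_pos by (simp add: power2_eq_square)
  also have "\<dots> \<le> R2 ?A"
  proof -
    have "real (5 * (3 ^ n)\<^sup>2 * (s choose 2)) \<le> real (N2 ?A)"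
      using N2_nonincidence_mat[of n] unfolding s of_nat_le_iff .
    moreover have "dim_row ?A = s"
      using nonincidence_mat_carrier[of "Suc (Suc n)"] s by auto
    ultimately show ?thesis
      by (simp add: R2_def q_def c_def divide_right_mono)
  qed
  also have "\<dots> \<le> R2_max s"
    unfolding R2_max_def using R2_values_finite
    by (rule Max_ge) (use nonincidence_mat_carrier[of "Suc (Suc n)"] invertible_nonincidence_mat s in auto)
  finally show ?thesis .
qed

end
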